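(* Let $\mathcal{C}$ be a hereditary class of finite simple graphs and let $f:\mathcal{C}\to\mathbb{R}$ be a function satisfying: (1) $f(G)\le |V(G)|$ whenever $G\in\mathcal{C}$ has no edges (i.e. $G$ is a collection of isolated vertices); and, for every $G\in\mathcal{C}$ with at least one edge, there exists a nonempty sequence of vertices $v_1,\dots,v_k$ of $G$ such that, setting $G_0=G$ and $G_i=G-v_1-v_2-\cdots-v_i$ for $0\le i\le k$: (2) $f(G_i-\operatorname{st}_{G_i}v_{i+1})+1\ge f(G)$ for all $0\le i\le k-1$; (3) $f(\overline{G_k})+|\operatorname{is}(G_k)|\ge f(G)$. Then for every graph $G\in\mathcal{C}$, \[\operatorname{pd}(G)\le |V(G)|-f(G).\]
   Context: All graphs are finite and simple. A class $\mathcal{C}$ of graphs is hereditary if $G-x\in\mathcal{C}$ whenever $G\in\mathcal{C}$ and $x$ is a vertex of $G$ (here $G-x$ is the induced subgraph on $V(G)\setminus\{x\}$). For a graph $H$ and a vertex $v$, $\operatorname{st}_H v$ is the induced subgraph of $H$ on $v$ together with its neighbors in $H$, and $H-\operatorname{st}_H v$ denotes $H$ with these vertices deleted. $\operatorname{is}(H)$ is the set of isolated vertices of $H$ and $\overline{H}=H-\operatorname{is}(H)$. For a graph $G$ with vertex set $\{x_1,\dots,x_n\}$ and a fixed field $\mathbf{k}$, let $S=\mathbf{k}[x_1,\dots,x_n]$ and let $I(G)=(x_ix_j : (x_i,x_j)\text{ an edge of }G)$ be the edge ideal; $\operatorname{pd}(G)$ denotes the projective dimension of $S/I(G)$ over $S$.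 *)

theory Defs
  imports Complex_Main "HOL-Library.Poly_Mapping"
begin

text \<open>A graph is a pair (V, E) of a vertex set and a set of ordered pairs;
  an undirected edge {u,v} is represented by both (u,v) and (v,u).\<close>

type_synonym 'v graph = "'v set \<times> ('v \<times> 'v) set"

definition verts :: "'v graph \<Rightarrow> 'v set" where "verts G = fst G"
definition edges :: "'v graph \<Rightarrow> ('v \<times> 'v) set" where "edges G = snd G"

definition simple_graph :: "'v graph \<Rightarrow> bool" where
  "simple_graph G \<longleftrightarrow> finite (verts G) \<and> edges G \<subseteq> verts G \<times> verts G
     \<and> sym (edges G) \<and> irrefl (edges G)"

definition induced :: "'v graph \<Rightarrow> 'v set \<Rightarrow> 'v graph" where
  "induced G W = (verts G \<inter> W, edges G \<inter> (W \<times> W))"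

definition del_vertex :: "'v graph \<Rightarrow> 'v \<Rightarrow> 'v graph" where
  "del_vertex G x = induced G (verts G - {x})"

definition del_vertices :: "'v graph \<Rightarrow> 'v list \<Rightarrow> 'v graph" where
  "del_vertices G xs = foldl del_vertex G xs"

definition star_verts :: "'v graph \<Rightarrow> 'v \<Rightarrow> 'v set" where
  "star_verts H v = {v} \<union> {u \<in> verts H. (v, u) \<in> edges H}"

definition star :: "'v graph \<Rightarrow> 'v \<Rightarrow> 'v graph" where
  "star H v = induced H (star_verts H v)"

definition del_star :: "'v graph \<Rightarrow> 'v \<Rightarrow> 'v graph" where
  "del_star H v = induced H (verts H - star_verts H v)"

definition isolated :: "'v graph \<Rightarrow> 'v set" where
  "isolated H = {v \<in> verts H. \<forall>u. (v, u) \<notin> edges H}"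

definition del_isolated :: "'v graph \<Rightarrow> 'v graph" where
  "del_isolated H = induced H (verts H - isolated H)"

definition hereditary :: "'v graph set \<Rightarrow> bool" where
  "hereditary C \<longleftrightarrow> (\<forall>G\<in>C. \<forall>x\<in>verts G. del_vertex G x \<in> C)"

text \<open>Multivariate polynomials over 'k in variables indexed by 'v:
  maps from monomials (exponent vectors 'v \<Rightarrow>0 nat) to coefficients.\<close>

type_synonym ('v, 'k) mpoly = "('v \<Rightarrow>\<^sub>0 nat) \<Rightarrow>\<^sub>0 'k"

definition Var :: "'v \<Rightarrow> ('v, 'k::comm_ring_1) mpoly" where
  "Var v = Poly_Mapping.single (Poly_Mapping.single v 1) 1"

definition polyring :: "'v set \<Rightarrow> ('v, 'k::comm_ring_1) mpoly set" where
  "polyring V = {p. \<forall>m \<in> Poly_Mapping.keys p. Poly_Mapping.keys m \<subseteq> V}"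

definition edge_ideal :: "'v graph \<Rightarrow> ('v, 'k::comm_ring_1) mpoly set" where
  "edge_ideal G = {p. \<exists>c. (\<forall>e \<in> edges G. c e \<in> polyring (verts G)) \<and>
      p = (\<Sum>e\<in>edges G. c e * (Var (fst e) * Var (snd e)))}"

definition free_mod :: "'v set \<Rightarrow> nat \<Rightarrow> (nat \<Rightarrow> ('v, 'k::comm_ring_1) mpoly) set" where
  "free_mod V b = {x. (\<forall>i<b. x i \<in> polyring V) \<and> (\<forall>i\<ge>b. x i = 0)}"

definition mat_apply :: "nat \<Rightarrow> nat \<Rightarrow> (nat \<Rightarrow> nat \<Rightarrow> ('v, 'k::comm_ring_1) mpoly)
    \<Rightarrow> (nat \<Rightarrow> ('v, 'k) mpoly) \<Rightarrow> (nat \<Rightarrow> ('v, 'k) mpoly)" where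
  "mat_apply a b M x = (\<lambda>r. if r < a then (\<Sum>c<b. M r c * x c) else 0)"

definition is_matrix :: "'v set \<Rightarrow> nat \<Rightarrow> nat \<Rightarrow> (nat \<Rightarrow> nat \<Rightarrow> ('v, 'k::comm_ring_1) mpoly) \<Rightarrow> bool" where
  "is_matrix V a b M \<longleftrightarrow> (\<forall>r<a. \<forall>c<b. M r c \<in> polyring V)"

text \<open>A free resolution of S/I(G) of length n:
  0 \<rightarrow> S^(b n) \<rightarrow> ... \<rightarrow> S^(b 1) \<rightarrow> S^(b 0) = S \<rightarrow> S/I(G) \<rightarrow> 0,
  where d i : S^(b i) \<rightarrow> S^(b (i-1)) for 1 \<le> i \<le> n.  Exactness at S^(b 0) = S means
  ker(S \<rightarrow> S/I) = I(G) equals the image of d 1 (for n = 0: I(G) = 0);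
  exactness at S^(b i), 1 \<le> i < n: ker d i = im d (i+1);
  exactness at S^(b n): d n injective.\<close>

definition ker_at :: "'v graph \<Rightarrow> (nat \<Rightarrow> nat) \<Rightarrow> (nat \<Rightarrow> nat \<Rightarrow> nat \<Rightarrow> ('v, 'k::comm_ring_1) mpoly)
    \<Rightarrow> nat \<Rightarrow> (nat \<Rightarrow> ('v, 'k) mpoly) set" where
  "ker_at G b d i =
     (if i = 0 then {x \<in> free_mod (verts G) 1. x 0 \<in> edge_ideal G}
      else {x \<in> free_mod (verts G) (b i). mat_apply (b (i - 1)) (b i) (d i) x = (\<lambda>_. 0)})"

definition free_resolution :: "'v graph \<Rightarrow> nat \<Rightarrow> (nat \<Rightarrow> nat)
    \<Rightarrow> (nat \<Rightarrow> nat \<Rightarrow> nat \<Rightarrow> ('v, 'k::comm_ring_1) mpoly) \<Rightarrow> bool" where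
  "free_resolution G n b d \<longleftrightarrow>
     b 0 = 1 \<and>
     (\<forall>i\<in>{1..n}. is_matrix (verts G) (b (i - 1)) (b i) (d i)) \<and>
     (\<forall>i<n. ker_at G b d i = mat_apply (b i) (b (Suc i)) (d (Suc i)) ` free_mod (verts G) (b (Suc i))) \<and>
     ker_at G b d n = {\<lambda>_. 0}"

text \<open>pd(G) = projective dimension of S/I(G) over S, i.e. the minimal length of a
  (finite) free resolution of S/I(G); the field is given by the type 'k.\<close>
definition pd :: "'k::field itself \<Rightarrow> 'v graph \<Rightarrow> nat" where
  "pd (TYPE('k)) G = (LEAST n. \<exists>b (d :: nat \<Rightarrow> nat \<Rightarrow> nat \<Rightarrow> ('v, 'k) mpoly). free_resolution G n b d)"

end

theory Submission
  imports Defs "HOL-Library.Function_Algebras" "HOL-Library.Set_Algebras"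
begin

text \<open>
  For a vertex \<open>x\<close> of \<open>H\<close> let \<open>J\<close> be generated by \<open>I(H - st x)\<close> and the neighbours of \<open>x\<close>. Then
  \<open>I(H) = I(H - x) + x J\<close>, where \<open>x\<close> is a nonzerodivisor modulo \<open>I(H - x) \<subseteq> J\<close>, so that
  \<open>I(H - x) \<inter> x J = x I(H - x)\<close>. The Mayer-Vietoris sequence
  \<open>0 \<rightarrow> A \<inter> B \<rightarrow> A \<oplus> B \<rightarrow> A + B \<rightarrow> 0\<close> for \<open>A = I(H - x)\<close> and \<open>B = x J\<close> thus bounds the length of a
  resolution of \<open>I(H)\<close>. Taking the unit ideal for \<open>J\<close>, the same argument shows that adding a new
  variable to a monomial ideal raises the projective dimension by at most one. Hence
  \<open>pd H \<le> max (pd (H - x) + 1) (pd (H - st x) + deg x)\<close>, and iterating this along \<open>v\<^sub>1, \<dots>, v\<^sub>k\<close>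
  gives the theorem by induction on the number of vertices. All ideals are taken in the polynomial
  ring on the vertices of the original graph, so the ring never changes.
\<close>

section \<open>Linear combinations of vectors\<close>

definition vscale :: "'a::comm_ring_1 \<Rightarrow> ('i \<Rightarrow> 'a) \<Rightarrow> 'i \<Rightarrow> 'a"  (infixr \<open>*\<^sub>v\<close> 75)
  where "r *\<^sub>v x = (\<lambda>i. r * x i)"

definition lincomb :: "nat \<Rightarrow> (nat \<Rightarrow> 'i \<Rightarrow> 'a::comm_ring_1) \<Rightarrow> (nat \<Rightarrow> 'a) \<Rightarrow> 'i \<Rightarrow> 'a"
  where "lincomb b g x = (\<Sum>j<b. x j *\<^sub>v g j)"

definition unit_vec :: "'i \<Rightarrow> 'i \<Rightarrow> 'a::zero_neq_one"
  where "unit_vec j = (\<lambda>i. if i = j then 1 else 0)"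

definition join :: "nat \<Rightarrow> (nat \<Rightarrow> 'b) \<Rightarrow> (nat \<Rightarrow> 'b) \<Rightarrow> nat \<Rightarrow> 'b"
  where "join a x y = (\<lambda>i. if i < a then x i else y (i - a))"

definition drop_coords :: "nat \<Rightarrow> (nat \<Rightarrow> 'b) \<Rightarrow> nat \<Rightarrow> 'b"
  where "drop_coords a z = (\<lambda>i. z (a + i))"

definition kernel :: "'b set \<Rightarrow> ('b \<Rightarrow> 'c::zero) \<Rightarrow> 'b set"
  where "kernel B h = {x \<in> B. h x = 0}"

abbreviation linear_map :: "(('i \<Rightarrow> 'a::comm_ring_1) \<Rightarrow> 'j \<Rightarrow> 'a) \<Rightarrow> bool"
  where "linear_map \<equiv> module_hom (*\<^sub>v) (*\<^sub>v)"

lemma mem_kernel_iff [simp]: "x \<in> kernel B h \<longleftrightarrow> x \<in> B \<and> h x = 0"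
  by (simp add: kernel_def)

lemma vscale_apply: "(r *\<^sub>v x) i = r * x i"
  by (simp add: vscale_def)

interpretation vec: module "(*\<^sub>v) :: 'a::comm_ring_1 \<Rightarrow> ('i \<Rightarrow> 'a) \<Rightarrow> 'i \<Rightarrow> 'a"
  by standard (auto simp: vscale_def fun_eq_iff algebra_simps)

lemma linear_map_iff:
  "linear_map h \<longleftrightarrow> (\<forall>x y. h (x + y) = h x + h y) \<and> (\<forall>r x. h (r *\<^sub>v x) = r *\<^sub>v h x)"
  by (auto simp: module_hom_iff vec.module_axioms)

lemma sum_fun_apply: "(\<Sum>j\<in>A. h j) i = (\<Sum>j\<in>A. h j i)"
  for h :: "'b \<Rightarrow> 'c \<Rightarrow> 'a::comm_monoid_add"
  by (induction A rule: infinite_finite_induct) auto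

lemma lincomb_apply: "lincomb b g x i = (\<Sum>j<b. g j i * x j)"
  by (simp add: lincomb_def sum_fun_apply vscale_apply mult.commute)

lemma lincomb_cong:
  "(\<And>j. j < b \<Longrightarrow> g j = h j) \<Longrightarrow> (\<And>j. j < b \<Longrightarrow> x j = y j) \<Longrightarrow> lincomb b g x = lincomb b h y"
  by (simp add: lincomb_def)

lemma linear_map_lincomb: "linear_map (lincomb b g)"
  by (simp add: linear_map_iff lincomb_def vscale_apply vec.scale_left_distrib sum.distrib
      vec.scale_sum_right)

lemma linear_map_vscale: "linear_map ((*\<^sub>v) r)"
  by (simp add: linear_map_iff vec.scale_right_distrib mult.commute)

lemma linear_map_drop_coords: "linear_map (drop_coords a)"
  by (simp add: linear_map_iff drop_coords_def vscale_def fun_eq_iff)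

lemma lincomb_0_right [simp]: "lincomb b g 0 = 0"
  by (rule module_hom.zero[OF linear_map_lincomb])

lemma lincomb_minus_right: "lincomb b g (- x) = - lincomb b g x"
  by (rule module_hom.neg[OF linear_map_lincomb])

lemma linear_map_lincomb_eq: "linear_map h \<Longrightarrow> h (lincomb b g x) = lincomb b (h \<circ> g) x"
  by (simp add: lincomb_def module_hom.sum module_hom.scale)

lemma lincomb_unit_vec: "j < b \<Longrightarrow> lincomb b g (unit_vec j) = g j"
  by (simp add: fun_eq_iff lincomb_apply unit_vec_def if_distrib cong: if_cong)

lemma lincomb_of_unit_vecs: "lincomb b unit_vec x = (\<lambda>i. if i < b then x i else 0)"
proof
  fix i
  have "lincomb b unit_vec x i = (\<Sum>j<b. if j = i then x j else 0)"
    unfolding lincomb_apply by (rule sum.cong) (auto simp: unit_vec_def)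
  then show "lincomb b unit_vec x i = (if i < b then x i else 0)"
    by simp
qed

lemma drop_coords_join [simp]: "drop_coords a (join a x y) = y"
  by (simp add: drop_coords_def join_def)

lemma lincomb_join_right [simp]: "lincomb a g (join a x y) = lincomb a g x"
  by (rule lincomb_cong) (simp_all add: join_def)

lemma lincomb_join_left:
  "lincomb (a + b) (join a e g) z = lincomb a e z + lincomb b g (drop_coords a z)"
  unfolding lincomb_def drop_coords_def join_def by (induction b) (auto simp: add.assoc)

section \<open>Submodules with finite free resolutions\<close>

locale unital_subring =
  fixes R :: "'a::comm_ring_1 set"
  assumes one_mem: "1 \<in> R"
    and add_mem: "p \<in> R \<Longrightarrow> q \<in> R \<Longrightarrow> p + q \<in> R"
    and mult_mem: "p \<in> R \<Longrightarrow> q \<in> R \<Longrightarrow> p * q \<in> R"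
    and uminus_mem: "p \<in> R \<Longrightarrow> - p \<in> R"
begin

lemma zero_mem: "0 \<in> R"
  using add_mem[OF one_mem uminus_mem[OF one_mem]] by simp

text \<open>Vectors are padded with zeros, so \<open>free a \<subseteq> free (a + b)\<close> is the inclusion of the first
  summand.\<close>

definition free :: "nat \<Rightarrow> (nat \<Rightarrow> 'a) set"
  where "free b = {x. (\<forall>i<b. x i \<in> R) \<and> (\<forall>i\<ge>b. x i = 0)}"

definition submodule :: "('i \<Rightarrow> 'a) set \<Rightarrow> bool"
  where "submodule M \<longleftrightarrow>
    0 \<in> M \<and> (\<forall>x\<in>M. \<forall>y\<in>M. x + y \<in> M) \<and> (\<forall>r\<in>R. \<forall>x\<in>M. r *\<^sub>v x \<in> M)"

definition syz :: "nat \<Rightarrow> (nat \<Rightarrow> 'i \<Rightarrow> 'a) \<Rightarrow> (nat \<Rightarrow> 'a) set"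
  where "syz b g = kernel (free b) (lincomb b g)"

text \<open>\<open>resolvable n M\<close> asks for a resolution \<open>0 \<rightarrow> F\<^sub>n \<rightarrow> \<dots> \<rightarrow> F\<^sub>1 \<rightarrow> M \<rightarrow> 0\<close> with \<open>n\<close> terms, so for an
  ideal \<open>I\<close> it says that the projective dimension of \<open>R/I\<close> (not of \<open>I\<close>) is at most \<open>n\<close>.\<close>

fun resolvable :: "nat \<Rightarrow> (nat \<Rightarrow> 'a) set \<Rightarrow> bool" where
  "resolvable 0 M \<longleftrightarrow> M = {0}"
| "resolvable (Suc n) M \<longleftrightarrow> (\<exists>b g. M = lincomb b g ` free b \<and> resolvable n (syz b g))"

declare resolvable.simps [simp del]

lemma resolvable_SucE:
  assumes "resolvable (Suc n) M"
  obtains b g where "M = lincomb b g ` free b" "resolvable n (syz b g)"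
  using assms by (auto simp: resolvable.simps)

lemma resolvable_SucI: "M = lincomb b g ` free b \<Longrightarrow> resolvable n (syz b g) \<Longrightarrow> resolvable (Suc n) M"
  by (auto simp: resolvable.simps)

lemma submoduleD:
  assumes "submodule M"
  shows "0 \<in> M" "x \<in> M \<Longrightarrow> y \<in> M \<Longrightarrow> x + y \<in> M" "r \<in> R \<Longrightarrow> x \<in> M \<Longrightarrow> r *\<^sub>v x \<in> M"
    "x \<in> M \<Longrightarrow> - x \<in> M"
  using assms uminus_mem[OF one_mem] vec.scale_minus_left[of 1 x]
  by (auto simp: submodule_def dest!: bspec[of R _ "-1"])

lemma submodule_diff: "submodule M \<Longrightarrow> x \<in> M \<Longrightarrow> y \<in> M \<Longrightarrow> x - y \<in> M"
  using submoduleD(2,4)[of M] by (metis diff_conv_add_uminus)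

lemma submodule_0: "submodule {0}"
  by (simp add: submodule_def)

lemma submodule_free: "submodule (free b)"
  by (simp add: submodule_def free_def vscale_apply zero_mem add_mem mult_mem)

lemma submodule_image:
  assumes "submodule M" "linear_map h"
  shows "submodule (h ` M)"
proof -
  interpret h: module_hom "(*\<^sub>v)" "(*\<^sub>v)" h by fact
  have "0 \<in> h ` M"
    using submoduleD(1)[OF assms(1)] h.zero by force
  moreover have "h x + h y \<in> h ` M" if "x \<in> M" "y \<in> M" for x y
    using submoduleD(2)[OF assms(1) that] h.add by (metis imageI)
  moreover have "r *\<^sub>v h x \<in> h ` M" if "r \<in> R" "x \<in> M" for r x
    using submoduleD(3)[OF assms(1) that] h.scale by (metis imageI)
  ultimately show ?thesis by (auto simp: submodule_def)
qed

lemma submodule_kernel: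
  assumes "submodule M" "linear_map h"
  shows "submodule (kernel M h)"
proof -
  interpret h: module_hom "(*\<^sub>v)" "(*\<^sub>v)" h by fact
  show ?thesis using assms(1) by (simp add: submodule_def kernel_def h.add h.scale)
qed

lemma submodule_lincomb_image: "submodule (lincomb b g ` free b)"
  by (intro submodule_image submodule_free linear_map_lincomb)

lemma submodule_syz: "submodule (syz b g)"
  unfolding syz_def by (intro submodule_kernel submodule_free linear_map_lincomb)

lemma syz_subset_free: "syz b g \<subseteq> free b"
  by (auto simp: syz_def)

lemma coord_mem: "x \<in> free b \<Longrightarrow> x i \<in> R"
  using zero_mem by (cases "i < b") (auto simp: free_def)

lemma free_0: "free 0 = {0}"
  by (auto simp: free_def fun_eq_iff)

lemma unit_vec_mem_free: "j < b \<Longrightarrow> unit_vec j \<in> free b"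
  by (auto simp: free_def unit_vec_def zero_mem one_mem)

lemma join_mem_free: "x \<in> free a \<Longrightarrow> y \<in> free b \<Longrightarrow> join a x y \<in> free (a + b)"
  by (auto simp: free_def join_def)

lemma drop_coords_mem_free: "z \<in> free (a + b) \<Longrightarrow> drop_coords a z \<in> free b"
  by (auto simp: free_def drop_coords_def)

lemma generator_mem: "j < b \<Longrightarrow> g j \<in> lincomb b g ` free b"
  using lincomb_unit_vec unit_vec_mem_free by (metis imageI)

lemma lincomb_mem:
  assumes "submodule M" "\<And>j. j < b \<Longrightarrow> g j \<in> M" "x \<in> free b"
  shows "lincomb b g x \<in> M"
proof -
  have "(\<Sum>j<k. x j *\<^sub>v g j) \<in> M" if "k \<le> b" for k
    using that
    by (induction k) (auto intro!: submoduleD[OF assms(1)] assms(2) coord_mem[OF assms(3)])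
  then show ?thesis by (simp add: lincomb_def)
qed

lemma lincomb_truncate_mem:
  assumes "z \<in> free (a + b)"
  shows "lincomb a e z \<in> lincomb a e ` free a"
proof -
  have "join a z 0 \<in> free a"
    using assms by (auto simp: free_def join_def)
  then show ?thesis
    by (metis imageI lincomb_join_right)
qed

lemma resolvable_submodule: "resolvable n M \<Longrightarrow> submodule M"
  by (cases n) (auto simp: resolvable.simps submodule_0 submodule_lincomb_image)

lemma resolvable_Suc: "resolvable n M \<Longrightarrow> resolvable (Suc n) M"
proof (induction n arbitrary: M)
  case 0
  then show ?case
    by (intro resolvable_SucI[of _ 0 0]) (auto simp: resolvable.simps free_0 syz_def)
next
  case (Suc n)
  then show ?case by (metis resolvable_SucE resolvable_SucI)
qed

lemma resolvable_mono: "resolvable n M \<Longrightarrow> n \<le> m \<Longrightarrow> resolvable m M"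
  by (induction m rule: nat_induct) (auto simp: le_Suc_eq resolvable_Suc)

lemma resolvable_free: "resolvable (Suc 0) (free b)"
proof (rule resolvable_SucI)
  have "lincomb b unit_vec x = x" if "x \<in> free b" for x
    using that by (auto simp: lincomb_of_unit_vecs free_def)
  then show "free b = lincomb b unit_vec ` free b" "resolvable 0 (syz b unit_vec)"
    using submoduleD(1)[OF submodule_free] by (force simp: syz_def resolvable.simps)+
qed

lemma resolvable_image:
  assumes "resolvable n M" "linear_map h" and inj: "\<And>x. x \<in> M \<Longrightarrow> h x = 0 \<Longrightarrow> x = 0"
  shows "resolvable n (h ` M)"
proof (cases n)
  case 0
  then show ?thesis
    using assms(1) module_hom.zero[OF assms(2)] by (simp add: resolvable.simps)
next
  case (Suc k)
  then obtain b g where M_eq: "M = lincomb b g ` free b" and "resolvable k (syz b g)"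
    using assms(1) by (auto elim: resolvable_SucE)
  moreover have "h ` M = lincomb b (h \<circ> g) ` free b"
    using linear_map_lincomb_eq[OF assms(2)] by (simp add: M_eq image_image)
  moreover have "syz b (h \<circ> g) = syz b g"
    using inj module_hom.zero[OF assms(2)]
    by (auto simp: syz_def M_eq simp flip: linear_map_lincomb_eq[OF assms(2)])
  ultimately show ?thesis
    unfolding Suc by (metis resolvable_SucI)
qed

lemma lincomb_join_image:
  "lincomb (a + b) (join a e g) ` free (a + b) = lincomb a e ` free a + lincomb b g ` free b"
  (is "?L = ?R")
proof
  show "?L \<subseteq> ?R"
    by (auto simp: lincomb_join_left
        intro!: set_plus_intro lincomb_truncate_mem imageI[OF drop_coords_mem_free])
next
  have "lincomb a e x + lincomb b g y = lincomb (a + b) (join a e g) (join a x y)" for x y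
    by (simp add: lincomb_join_left)
  then show "?R \<subseteq> ?L"
    using join_mem_free by (force elim!: set_plus_elim)
qed

lemma kernel_drop_coords_syz: "kernel (syz (a + b) (join a e g)) (drop_coords a) = syz a e"
proof -
  have "z \<in> free (a + b)" "drop_coords a z = 0" if "z \<in> free a" for z
    using that by (auto simp: free_def drop_coords_def fun_eq_iff) (metis not_less zero_mem)
  moreover have "z \<in> free a" if "z \<in> free (a + b)" "drop_coords a z = 0" for z
    using that by (auto simp: free_def drop_coords_def fun_eq_iff) (metis le_add_diff_inverse)
  ultimately show ?thesis
    by (auto simp: syz_def lincomb_join_left)
qed

lemma lincomb_join_extension:
  assumes "submodule B" "linear_map h" and lifts_mem: "\<And>j. j < c \<Longrightarrow> g j \<in> B"
    and kernel_eq: "kernel B h = lincomb a e ` free a"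
    and image_eq: "h ` B = lincomb c (h \<circ> g) ` free c"
  shows "B = lincomb (a + c) (join a e g) ` free (a + c)"
proof -
  interpret h: module_hom "(*\<^sub>v)" "(*\<^sub>v)" h by fact
  have lift_mem: "lincomb c g v \<in> B" if "v \<in> free c" for v
    using lincomb_mem[OF \<open>submodule B\<close> lifts_mem that] .
  have "lincomb a e ` free a + lincomb c g ` free c \<subseteq> B"
    using submoduleD(2)[OF \<open>submodule B\<close>] lift_mem
    by (auto simp flip: kernel_eq elim!: set_plus_elim)
  moreover have "x \<in> lincomb a e ` free a + lincomb c g ` free c" if "x \<in> B" for x
  proof -
    have "h x \<in> lincomb c (h \<circ> g) ` free c"
      using that by (simp flip: image_eq)
    then obtain v where v_mem: "v \<in> free c" and "h x = lincomb c (h \<circ> g) v"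
      by (metis imageE)
    then have "x - lincomb c g v \<in> lincomb a e ` free a"
      using submodule_diff[OF \<open>submodule B\<close> that lift_mem]
      by (simp add: h.diff linear_map_lincomb_eq[OF \<open>linear_map h\<close>] flip: kernel_eq)
    with v_mem show ?thesis
      by (metis diff_add_cancel imageI set_plus_intro)
  qed
  ultimately show ?thesis
    unfolding lincomb_join_image by blast
qed

lemma drop_coords_syz_extension:
  assumes "submodule B" "linear_map h" and lifts_mem: "\<And>j. j < c \<Longrightarrow> g j \<in> B"
    and kernel_eq: "kernel B h = lincomb a e ` free a"
  shows "drop_coords a ` syz (a + c) (join a e g) = syz c (h \<circ> g)"
proof -
  interpret h: module_hom "(*\<^sub>v)" "(*\<^sub>v)" h by fact
  note lift = linear_map_lincomb_eq[OF \<open>linear_map h\<close>, of c g]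
  show ?thesis
  proof (intro equalityI subsetI)
    fix v
    assume "v \<in> drop_coords a ` syz (a + c) (join a e g)"
    then obtain z where z_mem: "z \<in> free (a + c)" and v_eq: "v = drop_coords a z"
      and relation: "lincomb a e z + lincomb c g v = 0"
      by (auto simp: syz_def lincomb_join_left)
    have "h (lincomb a e z) = 0"
      using lincomb_truncate_mem[OF z_mem, of e] by (simp flip: kernel_eq)
    then have "h (lincomb c g v) = 0"
      using relation h.add h.zero by (metis add_0)
    then show "v \<in> syz c (h \<circ> g)"
      using drop_coords_mem_free z_mem by (simp add: syz_def lift v_eq)
  next
    fix v
    assume "v \<in> syz c (h \<circ> g)"
    then have v_mem: "v \<in> free c" and "h (lincomb c g v) = 0"
      by (auto simp: syz_def lift)
    then have "- lincomb c g v \<in> lincomb a e ` free a"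
      using submoduleD(4)[OF \<open>submodule B\<close> lincomb_mem[OF \<open>submodule B\<close> lifts_mem]]
      by (simp add: h.neg flip: kernel_eq)
    then obtain u where "u \<in> free a" "lincomb a e u = - lincomb c g v"
      by (metis imageE)
    with v_mem have "join a u v \<in> syz (a + c) (join a e g)"
      by (simp add: syz_def lincomb_join_left join_mem_free)
    then show "v \<in> drop_coords a ` syz (a + c) (join a e g)"
      by (metis drop_coords_join imageI)
  qed
qed

lemma resolvable_horseshoe:
  assumes "submodule B" "linear_map h" "resolvable n (kernel B h)" "resolvable n (h ` B)"
  shows "resolvable n B"
  using assms
proof (induction n arbitrary: B h)
  case 0
  then have "h x = 0" if "x \<in> B" for x
    using imageI[OF that, of h] by (simp add: resolvable.simps)
  then have "kernel B h = B" by auto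
  with 0 show ?case by simp
next
  case (Suc n)
  obtain a e where kernel_eq: "kernel B h = lincomb a e ` free a" and "resolvable n (syz a e)"
    using Suc.prems(3) by (rule resolvable_SucE)
  obtain c g where image_eq: "h ` B = lincomb c g ` free c" and "resolvable n (syz c g)"
    using Suc.prems(4) by (rule resolvable_SucE)
  have "\<exists>x\<in>B. h x = g j" if "j < c" for j
    using generator_mem[OF that, of g] image_eq by (metis imageE)
  then obtain g' where lifts: "g' j \<in> B" "h (g' j) = g j" if "j < c" for j
    by metis
  have lincomb_lifts: "lincomb c (h \<circ> g') = lincomb c g"
    using lifts(2) by (intro ext lincomb_cong) auto
  have "drop_coords a ` syz (a + c) (join a e g') = syz c g"
    using drop_coords_syz_extension[OF Suc.prems(1,2) lifts(1) kernel_eq]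
    by (simp add: syz_def lincomb_lifts)
  then have "resolvable n (syz (a + c) (join a e g'))"
    using \<open>resolvable n (syz a e)\<close> \<open>resolvable n (syz c g)\<close>
    by (intro Suc.IH[OF submodule_syz linear_map_drop_coords[of a]])
      (simp_all add: kernel_drop_coords_syz)
  moreover have "B = lincomb (a + c) (join a e g') ` free (a + c)"
    using lincomb_join_extension[OF Suc.prems(1,2) lifts(1) kernel_eq] image_eq lincomb_lifts
    by simp
  ultimately show ?case
    by (metis resolvable_SucI)
qed

lemma lincomb_syz_join_image:
  "lincomb a e ` syz (a + b) (join a e g) = lincomb a e ` free a \<inter> lincomb b g ` free b"
proof (intro equalityI subsetI)
  fix x
  assume "x \<in> lincomb a e ` syz (a + b) (join a e g)"
  then obtain z where z_mem: "z \<in> free (a + b)" and x_eq: "x = lincomb a e z"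
    and relation: "x + lincomb b g (drop_coords a z) = 0"
    by (auto simp: syz_def lincomb_join_left)
  have "x = lincomb b g (- drop_coords a z)"
    using relation by (simp add: lincomb_minus_right eq_neg_iff_add_eq_0)
  moreover have "- drop_coords a z \<in> free b"
    using submoduleD(4)[OF submodule_free drop_coords_mem_free[OF z_mem]] .
  ultimately show "x \<in> lincomb a e ` free a \<inter> lincomb b g ` free b"
    using x_eq lincomb_truncate_mem[OF z_mem] by (metis IntI imageI)
next
  fix x
  assume "x \<in> lincomb a e ` free a \<inter> lincomb b g ` free b"
  then obtain u v where x_eq: "x = lincomb a e u"
    and "u \<in> free a" "v \<in> free b" "x = lincomb b g v"
    by blast
  then have "join a u (- v) \<in> syz (a + b) (join a e g)"
    using submoduleD(4)[OF submodule_free] lincomb_minus_right[of b g v]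
    by (simp add: syz_def lincomb_join_left join_mem_free)
  then show "x \<in> lincomb a e ` syz (a + b) (join a e g)"
    using x_eq by (metis imageI lincomb_join_right)
qed

text \<open>The syzygies of a joint cover of \<open>A\<close> and \<open>B\<close> map onto \<open>A \<inter> B\<close>, and the kernel of this map is
  the direct sum of the syzygies of \<open>A\<close> and those of \<open>B\<close>.\<close>

lemma resolvable_sum:
  assumes "resolvable (Suc k) A" "resolvable (Suc k) B" "resolvable k (A \<inter> B)"
  shows "resolvable (Suc k) (A + B)"
proof -
  obtain a e where A_eq: "A = lincomb a e ` free a" and "resolvable k (syz a e)"
    using assms(1) by (rule resolvable_SucE)
  obtain b g where B_eq: "B = lincomb b g ` free b" and "resolvable k (syz b g)"
    using assms(2) by (rule resolvable_SucE)
  define K where "K = syz (a + b) (join a e g)"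
  define D where "D = kernel K (lincomb a e)"
  have "submodule K"
    unfolding K_def by (rule submodule_syz)
  then have "submodule D"
    unfolding D_def by (rule submodule_kernel) (rule linear_map_lincomb)
  moreover have "kernel D (drop_coords a) = syz a e"
    using kernel_drop_coords_syz[of a b e g] by (auto simp: D_def K_def syz_def set_eq_iff)
  moreover have "drop_coords a ` D = syz b g"
  proof (intro equalityI subsetI)
    fix v
    assume "v \<in> syz b g"
    then have "join a 0 v \<in> D"
      using join_mem_free[OF submoduleD(1)[OF submodule_free], of v b a]
      by (simp add: D_def K_def syz_def lincomb_join_left)
    then show "v \<in> drop_coords a ` D"
      by (metis drop_coords_join imageI)
  qed (auto simp: D_def K_def syz_def lincomb_join_left drop_coords_mem_free)
  ultimately have "resolvable k D"
    using \<open>resolvable k (syz a e)\<close> \<open>resolvable k (syz b g)\<close> linear_map_drop_coords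
    by (metis resolvable_horseshoe)
  moreover have "lincomb a e ` K = A \<inter> B"
    unfolding K_def A_eq B_eq by (rule lincomb_syz_join_image)
  ultimately have "resolvable k K"
    using assms(3) \<open>submodule K\<close> linear_map_lincomb unfolding D_def
    by (metis resolvable_horseshoe)
  moreover have "A + B = lincomb (a + b) (join a e g) ` free (a + b)"
    by (simp add: A_eq B_eq lincomb_join_image)
  ultimately show ?thesis
    unfolding K_def by (metis resolvable_SucI)
qed

lemma resolvable_add_vscale:
  assumes "resolvable k M" "resolvable (Suc k) N" "M \<subseteq> N" "y \<in> R"
    and colon: "\<And>x. x \<in> N \<Longrightarrow> y *\<^sub>v x \<in> M \<Longrightarrow> x \<in> M"
    and regular: "\<And>x. x \<in> N \<Longrightarrow> y *\<^sub>v x = 0 \<Longrightarrow> x = 0"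
  shows "resolvable (Suc k) (M + (*\<^sub>v) y ` N)"
proof (rule resolvable_sum)
  show "resolvable (Suc k) M"
    using assms(1) by (rule resolvable_Suc)
  show "resolvable (Suc k) ((*\<^sub>v) y ` N)"
    using assms(2) linear_map_vscale regular by (rule resolvable_image)
  have "M \<inter> (*\<^sub>v) y ` N = (*\<^sub>v) y ` M"
    using colon \<open>M \<subseteq> N\<close> submoduleD(3)[OF resolvable_submodule[OF assms(1)] \<open>y \<in> R\<close>] by blast
  moreover have "resolvable k ((*\<^sub>v) y ` M)"
    using assms(1) linear_map_vscale regular \<open>M \<subseteq> N\<close> by (intro resolvable_image) auto
  ultimately show "resolvable k (M \<inter> (*\<^sub>v) y ` N)" by simp
qed

text \<open>\<open>\<delta> i\<close> lists the images of the basis vectors under the differential \<open>F\<^sub>i\<^sub>+\<^sub>1 \<rightarrow> F\<^sub>i\<close>.\<close>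

definition cycles ::
    "(nat \<Rightarrow> 'a) set \<Rightarrow> (nat \<Rightarrow> nat) \<Rightarrow> (nat \<Rightarrow> nat \<Rightarrow> nat \<Rightarrow> 'a) \<Rightarrow> nat \<Rightarrow> (nat \<Rightarrow> 'a) set"
  where "cycles M b \<delta> i = (case i of 0 \<Rightarrow> M | Suc j \<Rightarrow> syz (b i) (\<delta> j))"

definition resolution ::
    "(nat \<Rightarrow> 'a) set \<Rightarrow> nat \<Rightarrow> (nat \<Rightarrow> nat) \<Rightarrow> (nat \<Rightarrow> nat \<Rightarrow> nat \<Rightarrow> 'a) \<Rightarrow> bool"
  where "resolution M n b \<delta> \<longleftrightarrow>
    (\<forall>i<n. \<forall>j<b (Suc i). \<delta> i j \<in> free (b i)) \<and>
    (\<forall>i<n. cycles M b \<delta> i = lincomb (b (Suc i)) (\<delta> i) ` free (b (Suc i))) \<and>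
    cycles M b \<delta> n = {0}"

lemma resolvable_imp_resolution:
  assumes "resolvable n M" "M \<subseteq> free a"
  shows "\<exists>b \<delta>. b 0 = a \<and> resolution M n b \<delta>"
  using assms
proof (induction n arbitrary: M a)
  case 0
  then show ?case
    by (intro exI[of _ "\<lambda>_. a"] exI[of _ 0]) (simp add: resolution_def cycles_def resolvable.simps)
next
  case (Suc n)
  obtain b\<^sub>1 g where M_eq: "M = lincomb b\<^sub>1 g ` free b\<^sub>1" and "resolvable n (syz b\<^sub>1 g)"
    using Suc.prems(1) by (rule resolvable_SucE)
  then obtain b \<delta> where b_0: "b 0 = b\<^sub>1" and is_resolution: "resolution (syz b\<^sub>1 g) n b \<delta>"
    using Suc.IH syz_subset_free by blast
  define b' where "b' = case_nat a b"
  define \<delta>' where "\<delta>' = case_nat g \<delta>"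
  have cycles_Suc: "cycles M b' \<delta>' (Suc i) = cycles (syz b\<^sub>1 g) b \<delta> i" for i
    by (simp add: cycles_def b'_def \<delta>'_def b_0 split: nat.split)
  have "g j \<in> free a" if "j < b\<^sub>1" for j
    using generator_mem[OF that, of g] M_eq Suc.prems(2) by auto
  then have "\<delta>' i j \<in> free (b' i)" if "i < Suc n" "j < b' (Suc i)" for i j
    using that is_resolution by (auto simp: resolution_def b'_def \<delta>'_def b_0 split: nat.splits)
  moreover have "cycles M b' \<delta>' i = lincomb (b' (Suc i)) (\<delta>' i) ` free (b' (Suc i))"
    if "i < Suc n" for i
  proof (cases i)
    case 0
    then show ?thesis by (simp add: cycles_def b'_def \<delta>'_def b_0 M_eq)
  next
    case (Suc j)
    then show ?thesis
      using that is_resolution unfolding Suc cycles_Suc by (simp add: resolution_def b'_def \<delta>'_def)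
  qed
  moreover have "cycles M b' \<delta>' (Suc n) = {0}"
    using is_resolution by (simp add: cycles_Suc resolution_def)
  ultimately have "resolution M (Suc n) b' \<delta>'"
    by (simp add: resolution_def)
  then show ?case
    by (intro exI[of _ b'] exI[of _ \<delta>']) (simp add: b'_def)
qed

end

definition embed :: "'a::zero \<Rightarrow> nat \<Rightarrow> 'a"
  where "embed p = (\<lambda>i. if i = 0 then p else 0)"

lemma embed_apply_0 [simp]: "embed p 0 = p"
  by (simp add: embed_def)

lemma embed_0: "embed 0 = 0"
  by (simp add: embed_def fun_eq_iff)

lemma embed_eq_iff: "embed p = embed q \<longleftrightarrow> p = q"
  by (auto simp: embed_def fun_eq_iff)

lemma embed_add: "embed (p + q) = embed p + embed q" for p q :: "'a::monoid_add"
  by (simp add: embed_def fun_eq_iff)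

lemma embed_mult: "embed (r * p) = r *\<^sub>v embed p"
  by (simp add: embed_def vscale_def fun_eq_iff)

lemma embed_set_plus: "embed ` (I + J) = embed ` I + embed ` J" for I J :: "'a::monoid_add set"
  by (force simp: set_plus_def embed_add)

context unital_subring
begin

lemma free_1: "free 1 = embed ` R"
proof -
  have "x = embed (x 0)" if "x \<in> free 1" for x
    using that by (simp add: free_def embed_def fun_eq_iff)
  moreover have "embed p \<in> free 1" if "p \<in> R" for p
    using that by (simp add: free_def embed_def)
  ultimately show ?thesis
    using coord_mem by blast
qed

lemma resolvable_ideal_add_mult:
  assumes "resolvable k (embed ` I)" "resolvable (Suc k) (embed ` J)" "I \<subseteq> J" "y \<in> R"
    and "\<And>p. p \<in> J \<Longrightarrow> y * p \<in> I \<Longrightarrow> p \<in> I" "\<And>p. p \<in> J \<Longrightarrow> y * p = 0 \<Longrightarrow> p = 0"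
  shows "resolvable (Suc k) (embed ` (I + (*) y ` J))"
proof -
  have "resolvable (Suc k) (embed ` I + (*\<^sub>v) y ` embed ` J)"
    using assms
    by (intro resolvable_add_vscale)
      (auto simp: embed_eq_iff inj_image_mem_iff inj_def simp flip: embed_mult embed_0)
  then show ?thesis
    by (simp add: embed_set_plus embed_mult image_image)
qed

end

section \<open>Resolutions over polynomial rings\<close>

lemma keys_add_nat: "Poly_Mapping.keys (s + t) = Poly_Mapping.keys s \<union> Poly_Mapping.keys t"
  for s t :: "'a \<Rightarrow>\<^sub>0 nat"
  by (auto simp: in_keys_iff lookup_add)

interpretation poly: unital_subring "polyring V :: ('v, 'k::comm_ring_1) mpoly set" for V
proof
  fix p q :: "('v, 'k) mpoly"
  assume mem: "p \<in> polyring V" "q \<in> polyring V"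
  show "p + q \<in> polyring V"
    using mem keys_add[of p q] by (auto simp: polyring_def)
  show "p * q \<in> polyring V"
    using mem keys_mult[of p q] unfolding polyring_def by (fastforce simp: keys_add_nat)
qed (auto simp: polyring_def in_keys_iff)

lemma free_mod_eq: "free_mod V = poly.free V"
  by (simp add: fun_eq_iff free_mod_def poly.free_def)

lemma pd_le_if_resolvable:
  assumes "edge_ideal G \<subseteq> (polyring (verts G) :: ('v, 'k::field) mpoly set)"
    and "poly.resolvable (verts G) n (embed ` (edge_ideal G :: ('v, 'k) mpoly set))"
  shows "pd TYPE('k) G \<le> n"
proof -
  define M where "M = embed ` (edge_ideal G :: ('v, 'k) mpoly set)"
  have M_eq: "M = {x \<in> poly.free (verts G) 1. x 0 \<in> edge_ideal G}"
    using assms(1) by (auto simp: M_def poly.free_1 simp del: One_nat_def)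
  then have "M \<subseteq> poly.free (verts G) 1" by blast
  from poly.resolvable_imp_resolution[OF assms(2)[folded M_def] this]
  obtain b \<delta> where b_0: "b 0 = 1" and is_resolution: "poly.resolution (verts G) M n b \<delta>"
    by blast
  define d where "d i r c = \<delta> (i - 1) c r" for i r c
  have mat_apply_d: "mat_apply (b i) (b (Suc i)) (d (Suc i)) = lincomb (b (Suc i)) (\<delta> i)"
    if "i < n" for i
    using is_resolution that
    by (auto simp: poly.resolution_def fun_eq_iff mat_apply_def lincomb_apply d_def poly.free_def)
  have ker_at_d: "ker_at G b d i = poly.cycles (verts G) M b \<delta> i" if "i \<le> n" for i
    using that mat_apply_d[of "i - 1"]
    by (cases i)
      (auto simp: ker_at_def poly.cycles_def M_eq free_mod_eq poly.syz_def zero_fun_def)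
  have "free_resolution G n b d"
    unfolding free_resolution_def
  proof (intro conjI ballI allI impI)
    show "is_matrix (verts G) (b (i - 1)) (b i) (d i)" if "i \<in> {1..n}" for i
      using that is_resolution
      by (cases i) (auto simp: is_matrix_def d_def poly.resolution_def poly.free_def)
    show "ker_at G b d i = mat_apply (b i) (b (Suc i)) (d (Suc i)) ` free_mod (verts G) (b (Suc i))"
      if "i < n" for i
      using that is_resolution by (simp add: ker_at_d mat_apply_d free_mod_eq poly.resolution_def)
    show "ker_at G b d n = {\<lambda>_. 0}"
      using is_resolution by (simp add: ker_at_d poly.resolution_def zero_fun_def)
  qed (fact b_0)
  then show ?thesis
    unfolding pd_def by (intro Least_le) blast
qed

section \<open>Monomial ideals\<close>

definition monom_dvd :: "'a::plus \<Rightarrow> 'a \<Rightarrow> bool"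
  where "monom_dvd t m \<longleftrightarrow> (\<exists>s. m = t + s)"

definition mono_ideal :: "'v set \<Rightarrow> ('v \<Rightarrow>\<^sub>0 nat) set \<Rightarrow> ('v, 'k::comm_ring_1) mpoly set"
  where "mono_ideal V T = {p \<in> polyring V. \<forall>m\<in>Poly_Mapping.keys p. \<exists>t\<in>T. monom_dvd t m}"

abbreviation monom :: "('v \<Rightarrow>\<^sub>0 nat) \<Rightarrow> ('v, 'k::comm_ring_1) mpoly"
  where "monom t \<equiv> Poly_Mapping.single t 1"

abbreviation var :: "'v \<Rightarrow> 'v \<Rightarrow>\<^sub>0 nat"
  where "var y \<equiv> Poly_Mapping.single y 1"

lemma monom_dvd_refl [simp]: "monom_dvd t t"
  for t :: "'a::monoid_add"
  unfolding monom_dvd_def by (metis add.right_neutral)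

lemma monom_dvd_trans: "monom_dvd s t \<Longrightarrow> monom_dvd t m \<Longrightarrow> monom_dvd s m"
  for t :: "'a::semigroup_add"
  unfolding monom_dvd_def by (metis add.assoc)

lemma monom_dvd_add_left: "monom_dvd t m \<Longrightarrow> monom_dvd t (s + m)"
  for t :: "'a::ab_semigroup_add"
  unfolding monom_dvd_def by (metis add.left_commute)

lemma monom_dvd_coprime_cancel:
  fixes t x m :: "'v \<Rightarrow>\<^sub>0 nat"
  assumes "monom_dvd t (x + m)" "Poly_Mapping.keys t \<inter> Poly_Mapping.keys x = {}"
  shows "monom_dvd t m"
proof -
  obtain s where multiple: "x + m = t + s"
    using assms(1) by (auto simp: monom_dvd_def)
  have "m = t + (m - t)"
  proof (rule poly_mapping_eqI)
    fix v
    have "Poly_Mapping.lookup t v \<le> Poly_Mapping.lookup m v"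
    proof (cases "Poly_Mapping.lookup t v = 0")
      case False
      then have "Poly_Mapping.lookup x v = 0"
        using assms(2) by (auto simp: in_keys_iff)
      then show ?thesis
        using arg_cong[OF multiple, of "\<lambda>m. Poly_Mapping.lookup m v"] by (simp add: lookup_add)
    qed simp
    then show "Poly_Mapping.lookup m v = Poly_Mapping.lookup (t + (m - t)) v"
      by (simp add: lookup_add lookup_minus)
  qed
  then show ?thesis
    unfolding monom_dvd_def ..
qed

lemma sum_single_keys:
  "(\<Sum>m\<in>Poly_Mapping.keys p. Poly_Mapping.single m (Poly_Mapping.lookup p m)) = p"
  by (rule poly_mapping_eqI) (simp add: lookup_sum lookup_single when_def in_keys_iff)

lemma monom_mult_single: "monom t * Poly_Mapping.single m c = Poly_Mapping.single (t + m) c"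
  by (simp add: mult_single)

lemma lookup_monom_mult: "Poly_Mapping.lookup (monom t * p) (t + m) = Poly_Mapping.lookup p m"
proof -
  have "monom t * p =
      (\<Sum>k\<in>Poly_Mapping.keys p. Poly_Mapping.single (t + k) (Poly_Mapping.lookup p k))"
    by (subst sum_single_keys[of p, symmetric]) (simp add: sum_distrib_left monom_mult_single)
  then show ?thesis
    by (simp add: lookup_sum lookup_single when_def in_keys_iff)
qed

lemma keys_monom_mult: "Poly_Mapping.keys (monom t * p) = (+) t ` Poly_Mapping.keys p"
proof
  show "Poly_Mapping.keys (monom t * p) \<subseteq> (+) t ` Poly_Mapping.keys p"
    using keys_mult[of "monom t" p] by (auto split: if_splits)
qed (auto simp: in_keys_iff lookup_monom_mult)

lemma monom_mult_eq_0_iff: "monom t * p = 0 \<longleftrightarrow> p = 0"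
  by (metis keys_eq_empty image_is_empty keys_monom_mult)

lemma single_mem_polyring: "Poly_Mapping.keys m \<subseteq> V \<Longrightarrow> Poly_Mapping.single m c \<in> polyring V"
  by (simp add: polyring_def)

lemma mono_ideal_subset_polyring: "mono_ideal V T \<subseteq> polyring V"
  by (auto simp: mono_ideal_def)

lemma mono_ideal_empty: "mono_ideal V {} = {0}"
  by (auto simp: mono_ideal_def polyring_def)

lemma mono_ideal_one: "mono_ideal V {0} = polyring V"
  by (auto simp: mono_ideal_def monom_dvd_def)

lemma zero_mem_mono_ideal: "0 \<in> mono_ideal V T"
  by (simp add: mono_ideal_def poly.zero_mem)

lemma add_mem_mono_ideal: "p \<in> mono_ideal V T \<Longrightarrow> q \<in> mono_ideal V T \<Longrightarrow> p + q \<in> mono_ideal V T"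
  using keys_add[of p q] by (auto simp: mono_ideal_def poly.add_mem)

lemma sum_mem_mono_ideal: "(\<And>i. i \<in> A \<Longrightarrow> h i \<in> mono_ideal V T) \<Longrightarrow> sum h A \<in> mono_ideal V T"
  by (induction A rule: infinite_finite_induct)
    (auto intro: zero_mem_mono_ideal add_mem_mono_ideal)

lemma mult_mem_mono_ideal:
  assumes "r \<in> polyring V" "p \<in> mono_ideal V T"
  shows "r * p \<in> mono_ideal V T"
proof -
  have "\<exists>t\<in>T. monom_dvd t m" if m_mem: "m \<in> Poly_Mapping.keys (r * p)" for m
  proof -
    obtain s m' where "m = s + m'" "m' \<in> Poly_Mapping.keys p"
      using keys_mult[of r p] m_mem by blast
    then show ?thesis
      using assms(2) monom_dvd_add_left by (fastforce simp: mono_ideal_def)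
  qed
  then show ?thesis
    using assms by (auto simp: mono_ideal_def poly.mult_mem)
qed

lemma single_mem_mono_ideal:
  "t \<in> T \<Longrightarrow> Poly_Mapping.keys (t + s) \<subseteq> V \<Longrightarrow> Poly_Mapping.single (t + s) c \<in> mono_ideal V T"
  by (auto simp: mono_ideal_def single_mem_polyring monom_dvd_def)

lemma mono_ideal_induct [consumes 1, case_names zero add single]:
  assumes "p \<in> mono_ideal V T"
    and "P 0" "\<And>p q. P p \<Longrightarrow> P q \<Longrightarrow> P (p + q)"
    and "\<And>t s c. t \<in> T \<Longrightarrow> Poly_Mapping.keys (t + s) \<subseteq> V \<Longrightarrow> P (Poly_Mapping.single (t + s) c)"
  shows "P p"
proof -
  have monomials: "P (Poly_Mapping.single m (Poly_Mapping.lookup p m))"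
    if "m \<in> Poly_Mapping.keys p" for m
    using that assms(1,4) by (fastforce simp: mono_ideal_def polyring_def monom_dvd_def)
  have "P (\<Sum>m\<in>A. Poly_Mapping.single m (Poly_Mapping.lookup p m))"
    if "finite A" "A \<subseteq> Poly_Mapping.keys p" for A
    using that by (induction A rule: finite_induct) (auto intro: assms(2,3) monomials)
  from this[of "Poly_Mapping.keys p"] show ?thesis
    by (simp add: sum_single_keys)
qed

lemma mono_ideal_mono:
  "(\<And>t. t \<in> T \<Longrightarrow> \<exists>u\<in>U. monom_dvd u t) \<Longrightarrow> mono_ideal V T \<subseteq> mono_ideal V U"
  using monom_dvd_trans by (fastforce simp: mono_ideal_def)

lemma mono_ideal_colon_monom:
  assumes "p \<in> polyring V" "monom x * p \<in> mono_ideal V T"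
    and "\<And>t. t \<in> T \<Longrightarrow> Poly_Mapping.keys t \<inter> Poly_Mapping.keys x = {}"
  shows "p \<in> mono_ideal V T"
  using assms monom_dvd_coprime_cancel by (fastforce simp: mono_ideal_def keys_monom_mult)

lemma mono_ideal_Un: "mono_ideal V (T \<union> U) = mono_ideal V T + mono_ideal V U"
proof (intro equalityI subsetI)
  fix p :: "('a, 'b) mpoly"
  assume "p \<in> mono_ideal V (T \<union> U)"
  then show "p \<in> mono_ideal V T + mono_ideal V U"
  proof (induction rule: mono_ideal_induct)
    case zero
    show ?case
      using set_plus_intro[OF zero_mem_mono_ideal zero_mem_mono_ideal] by simp
  next
    case (add p q)
    then obtain a b c d where "p = a + b" "q = c + d"
      and "a \<in> mono_ideal V T" "c \<in> mono_ideal V T" "b \<in> mono_ideal V U" "d \<in> mono_ideal V U"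
      by (elim set_plus_elim)
    moreover from this have "p + q = (a + c) + (b + d)"
      by (simp add: algebra_simps)
    ultimately show ?case
      by (metis add_mem_mono_ideal set_plus_intro)
  next
    case (single t s c)
    have "Poly_Mapping.single (t + s) c + 0 \<in> mono_ideal V T + mono_ideal V U" if "t \<in> T"
      using that single(2) by (intro set_plus_intro single_mem_mono_ideal zero_mem_mono_ideal)
    moreover have "0 + Poly_Mapping.single (t + s) c \<in> mono_ideal V T + mono_ideal V U" if "t \<in> U"
      using that single(2) by (intro set_plus_intro single_mem_mono_ideal zero_mem_mono_ideal)
    ultimately show ?case
      using single(1) by auto
  qed
next
  have "mono_ideal V T \<subseteq> mono_ideal V (T \<union> U)" "mono_ideal V U \<subseteq> mono_ideal V (T \<union> U)"
    by (auto simp: mono_ideal_def)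
  then show "p \<in> mono_ideal V (T \<union> U)" if "p \<in> mono_ideal V T + mono_ideal V U" for p
    using that by (auto elim!: set_plus_elim intro!: add_mem_mono_ideal)
qed

lemma mono_ideal_shift:
  assumes "Poly_Mapping.keys x \<subseteq> V"
  shows "mono_ideal V ((+) x ` U) = (*) (monom x) ` mono_ideal V U"
proof (intro equalityI subsetI)
  fix p :: "('a, 'b) mpoly"
  assume "p \<in> mono_ideal V ((+) x ` U)"
  then show "p \<in> (*) (monom x) ` mono_ideal V U"
  proof (induction rule: mono_ideal_induct)
    case zero
    show ?case using zero_mem_mono_ideal by force
  next
    case (add p q)
    then obtain a b where "p = monom x * a" "q = monom x * b"
      "a \<in> mono_ideal V U" "b \<in> mono_ideal V U"
      by blast
    then show ?case
      by (simp add: add_mem_mono_ideal flip: distrib_left)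
  next
    case (single t s c)
    then obtain u where "u \<in> U" "t = x + u" by blast
    with single show ?case
      using single_mem_mono_ideal[of u U s V c]
      by (auto simp: keys_add_nat add.assoc simp flip: monom_mult_single)
  qed
next
  fix p :: "('a, 'b) mpoly"
  assume "p \<in> (*) (monom x) ` mono_ideal V U"
  then obtain q where q_mem: "q \<in> mono_ideal V U" and p_eq: "p = monom x * q" by blast
  have "monom x \<in> (polyring V :: ('a, 'b) mpoly set)"
    using assms by (rule single_mem_polyring)
  then have "p \<in> polyring V"
    using q_mem by (auto simp: p_eq mono_ideal_def poly.mult_mem)
  then show "p \<in> mono_ideal V ((+) x ` U)"
    using q_mem p_eq by (fastforce simp: mono_ideal_def keys_monom_mult monom_dvd_def add.assoc)
qed

definition monomial_pd_le :: "'k::comm_ring_1 itself \<Rightarrow> 'v set \<Rightarrow> ('v \<Rightarrow>\<^sub>0 nat) set \<Rightarrow> nat \<Rightarrow> bool"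
  where "monomial_pd_le TYPE('k) V T n \<longleftrightarrow>
    poly.resolvable V n (embed ` (mono_ideal V T :: ('v, 'k) mpoly set))"

lemma monomial_pd_le_empty: "monomial_pd_le TYPE('k::comm_ring_1) V {} 0"
  by (simp add: monomial_pd_le_def mono_ideal_empty embed_0 poly.resolvable.simps)

lemma monomial_pd_le_one: "monomial_pd_le TYPE('k::comm_ring_1) V {0} 1"
  using poly.resolvable_free by (simp add: monomial_pd_le_def mono_ideal_one flip: poly.free_1)

lemma monomial_pd_le_cong:
  assumes "\<And>t. t \<in> T \<Longrightarrow> \<exists>u\<in>U. monom_dvd u t" "\<And>u. u \<in> U \<Longrightarrow> \<exists>t\<in>T. monom_dvd t u"
  shows "monomial_pd_le TYPE('k::comm_ring_1) V T n \<longleftrightarrow> monomial_pd_le TYPE('k) V U n"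
proof -
  have "mono_ideal V T = (mono_ideal V U :: ('a, 'k) mpoly set)"
    using assms by (intro antisym mono_ideal_mono)
  then show ?thesis
    by (simp add: monomial_pd_le_def)
qed

lemma monomial_pd_le_Un_shift:
  assumes "Poly_Mapping.keys x \<subseteq> V"
    and coprime: "\<And>t. t \<in> T \<Longrightarrow> Poly_Mapping.keys t \<inter> Poly_Mapping.keys x = {}"
    and multiples: "\<And>t. t \<in> T \<Longrightarrow> \<exists>u\<in>U. monom_dvd u t"
    and "monomial_pd_le TYPE('k::comm_ring_1) V T n" "monomial_pd_le TYPE('k) V U m"
  shows "monomial_pd_le TYPE('k) V (T \<union> (+) x ` U) (max (Suc n) m)"
proof -
  let ?I = "mono_ideal V T :: ('a, 'k) mpoly set" and ?J = "mono_ideal V U :: ('a, 'k) mpoly set"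
  define k where "k = max n (m - 1)"
  have "poly.resolvable V k (embed ` ?I)" "poly.resolvable V (Suc k) (embed ` ?J)"
    using assms(4,5) by (auto simp: monomial_pd_le_def k_def elim!: poly.resolvable_mono)
  then have "poly.resolvable V (Suc k) (embed ` (?I + (*) (monom x) ` ?J))"
  proof (rule poly.resolvable_ideal_add_mult)
    show "?I \<subseteq> ?J"
      using multiples by (rule mono_ideal_mono)
    show "monom x \<in> (polyring V :: ('a, 'k) mpoly set)"
      using assms(1) by (rule single_mem_polyring)
    show "p \<in> ?I" if "p \<in> ?J" "monom x * p \<in> ?I" for p
      using that mono_ideal_subset_polyring coprime by (blast intro: mono_ideal_colon_monom)
  qed (simp add: monom_mult_eq_0_iff)
  then show ?thesis
    unfolding monomial_pd_le_def mono_ideal_Un mono_ideal_shift[OF assms(1)]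
    by (rule poly.resolvable_mono) (simp add: k_def)
qed

lemma monomial_pd_le_insert:
  assumes "Poly_Mapping.keys x \<subseteq> V"
    and "\<And>t. t \<in> T \<Longrightarrow> Poly_Mapping.keys t \<inter> Poly_Mapping.keys x = {}"
    and "monomial_pd_le TYPE('k::comm_ring_1) V T n"
  shows "monomial_pd_le TYPE('k) V (insert x T) (Suc n)"
  using monomial_pd_le_Un_shift[OF assms(1,2) _ assms(3) monomial_pd_le_one]
  by (simp add: monom_dvd_def)

lemma monomial_pd_le_Un_vars:
  assumes "finite N" "N \<subseteq> V" "\<And>t. t \<in> T \<Longrightarrow> Poly_Mapping.keys t \<inter> N = {}"
    and "monomial_pd_le TYPE('k::comm_ring_1) V T n"
  shows "monomial_pd_le TYPE('k) V (T \<union> var ` N) (n + card N)"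
  using assms(1,2,3)
proof (induction N rule: finite_induct)
  case empty
  then show ?case using assms(4) by simp
next
  case (insert y N)
  have "monomial_pd_le TYPE('k) V (insert (var y) (T \<union> var ` N)) (Suc (n + card N))"
  proof (rule monomial_pd_le_insert)
    show "Poly_Mapping.keys t \<inter> Poly_Mapping.keys (var y) = {}" if "t \<in> T \<union> var ` N" for t
      using that insert.hyps(2) insert.prems(2) by auto
  qed (use insert in auto)
  then show ?case
    using insert.hyps by simp
qed

section \<open>Graphs\<close>

lemma simple_graphD:
  assumes "simple_graph G"
  shows "finite (verts G)" "finite (edges G)" "(u, v) \<in> edges G \<Longrightarrow> u \<in> verts G"
    "(u, v) \<in> edges G \<Longrightarrow> v \<in> verts G" "(u, v) \<in> edges G \<Longrightarrow> (v, u) \<in> edges G"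
  using assms finite_subset[of "edges G" "verts G \<times> verts G"]
  by (auto simp: simple_graph_def sym_def)

lemma induced_simps [simp]:
  "verts (induced H W) = verts H \<inter> W" "edges (induced H W) = edges H \<inter> W \<times> W"
  by (simp_all add: induced_def verts_def edges_def)

lemma induced_induced [simp]: "induced (induced H W) W' = induced H (W \<inter> W')"
  by (auto simp: induced_def verts_def edges_def)

lemma induced_cong:
  assumes "simple_graph H" "verts H \<inter> W = verts H \<inter> W'"
  shows "induced H W = induced H W'"
proof -
  have "edges H \<inter> W \<times> W = edges H \<inter> W' \<times> W'"
    using assms(2) by (auto dest: simple_graphD(3,4)[OF assms(1)])
  with assms(2) show ?thesis
    by (simp add: induced_def)
qed

lemma induced_UNIV [simp]: "induced H UNIV = H"
  by (simp add: induced_def verts_def edges_def)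

lemma simple_graph_induced: "simple_graph H \<Longrightarrow> simple_graph (induced H W)"
  by (auto simp: simple_graph_def sym_def irrefl_def)

lemma del_vertex_eq_induced: "simple_graph H \<Longrightarrow> del_vertex H x = induced H (- {x})"
  unfolding del_vertex_def by (rule induced_cong) auto

lemma del_vertices_snoc: "del_vertices H (vs @ [x]) = del_vertex (del_vertices H vs) x"
  by (simp add: del_vertices_def)

lemma del_vertices_eq_induced:
  assumes "simple_graph H"
  shows "del_vertices H vs = induced H (- set vs)"
proof (induction vs rule: rev_induct)
  case Nil
  then show ?case by (simp add: del_vertices_def)
next
  case (snoc x vs)
  have "- set vs \<inter> - {x} = - set (vs @ [x])" by auto
  then show ?case
    by (simp add: del_vertices_snoc snoc del_vertex_eq_induced simple_graph_induced[OF assms])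
qed

lemma hereditary_induced:
  assumes "hereditary C" "G \<in> C" "simple_graph G"
  shows "induced G W \<in> C"
proof -
  have "induced G (- D) \<in> C" if "finite D" "D \<subseteq> verts G" for D
    using that
  proof (induction D rule: finite_induct)
    case empty
    then show ?case using assms(2) by simp
  next
    case (insert x D)
    then have "del_vertex (induced G (- D)) x \<in> C"
      using assms(1) by (auto simp: hereditary_def)
    moreover have "- D \<inter> - {x} = - insert x D" by auto
    ultimately show ?case
      by (simp add: del_vertex_eq_induced simple_graph_induced[OF assms(3)])
  qed
  from this[of "verts G - W"] have "induced G (- (verts G - W)) \<in> C"
    using simple_graphD(1)[OF assms(3)] by auto
  also have "induced G (- (verts G - W)) = induced G W"
    using assms(3) by (rule induced_cong) auto
  finally show ?thesis .
qed

definition neighbours :: "'v graph \<Rightarrow> 'v \<Rightarrow> 'v set"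
  where "neighbours H x = {u \<in> verts H. (x, u) \<in> edges H}"

lemma mem_neighbours_iff: "simple_graph H \<Longrightarrow> u \<in> neighbours H x \<longleftrightarrow> (x, u) \<in> edges H"
  by (auto simp: neighbours_def dest: simple_graphD)

lemma verts_del_star: "verts (del_star H x) = verts H - insert x (neighbours H x)"
  by (auto simp: del_star_def star_verts_def neighbours_def)

lemma edges_del_star:
  "simple_graph H \<Longrightarrow> edges (del_star H x) =
    {(u, v) \<in> edges H. u \<notin> insert x (neighbours H x) \<and> v \<notin> insert x (neighbours H x)}"
  by (auto simp: del_star_def star_verts_def neighbours_def dest: simple_graphD)

lemma verts_del_vertex: "verts (del_vertex H x) = verts H - {x}"
  by (auto simp: del_vertex_def)

lemma edges_del_vertex:
  "simple_graph H \<Longrightarrow> edges (del_vertex H x) = {(u, v) \<in> edges H. u \<noteq> x \<and> v \<noteq> x}"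
  by (auto simp: del_vertex_def dest: simple_graphD)

lemma edges_del_isolated: "simple_graph H \<Longrightarrow> edges (del_isolated H) = edges H"
  by (auto simp: del_isolated_def isolated_def dest: simple_graphD)

lemma card_verts_del_vertex:
  "simple_graph H \<Longrightarrow> x \<in> verts H \<Longrightarrow> card (verts (del_vertex H x)) + 1 = card (verts H)"
  using card_Suc_Diff1[of "verts H" x] by (simp add: verts_del_vertex simple_graphD(1))

lemma card_verts_del_star:
  assumes "simple_graph H" "x \<in> verts H"
  shows "card (verts (del_star H x)) + card (neighbours H x) + 1 = card (verts H)"
proof -
  have finite: "finite (verts H)" "finite (neighbours H x)" and "x \<notin> neighbours H x"
    using assms(1) by (auto simp: simple_graph_def irrefl_def neighbours_def)
  then have "card (insert x (neighbours H x)) = card (neighbours H x) + 1"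
    by simp
  moreover have "insert x (neighbours H x) \<subseteq> verts H"
    using assms(2) by (auto simp: neighbours_def)
  ultimately show ?thesis
    using finite card_mono[of "verts H" "insert x (neighbours H x)"]
    by (simp add: verts_del_star card_Diff_subset)
qed

lemma card_verts_del_isolated:
  assumes "simple_graph H"
  shows "card (verts (del_isolated H)) + card (isolated H) = card (verts H)"
proof -
  have "isolated H \<subseteq> verts H"
    by (auto simp: isolated_def)
  then show ?thesis
    using simple_graphD(1)[OF assms]
    by (simp add: del_isolated_def Int_absorb1 card_Diff_subset card_mono finite_subset)
qed

section \<open>Edge ideals\<close>

definition edge_monos :: "'v graph \<Rightarrow> ('v \<Rightarrow>\<^sub>0 nat) set"
  where "edge_monos G = (\<lambda>(u, v). var u + var v) ` edges G"

lemma Var_mult_Var: "Var u * Var v = monom (var u + var v)"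
  by (simp add: Var_def mult_single)

lemma zero_mem_edge_ideal: "0 \<in> edge_ideal G"
  unfolding edge_ideal_def by (intro CollectI exI[of _ "\<lambda>_. 0"]) (simp add: poly.zero_mem)

lemma add_mem_edge_ideal:
  assumes "p \<in> edge_ideal G" "q \<in> edge_ideal G"
  shows "p + q \<in> edge_ideal G"
proof -
  obtain c d where "\<forall>e\<in>edges G. c e \<in> polyring (verts G)" "\<forall>e\<in>edges G. d e \<in> polyring (verts G)"
    "p = (\<Sum>e\<in>edges G. c e * (Var (fst e) * Var (snd e)))"
    "q = (\<Sum>e\<in>edges G. d e * (Var (fst e) * Var (snd e)))"
    using assms unfolding edge_ideal_def by blast
  then show ?thesis
    unfolding edge_ideal_def
    by (intro CollectI exI[of _ "\<lambda>e. c e + d e"])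
      (simp add: sum.distrib distrib_right poly.add_mem)
qed

lemma mult_edge_mem_edge_ideal:
  assumes "finite (edges G)" "(u, v) \<in> edges G" "p \<in> polyring (verts G)"
  shows "p * (Var u * Var v) \<in> edge_ideal G"
proof -
  define c where "c e = (if e = (u, v) then p else 0)" for e
  have "(\<Sum>e\<in>edges G. c e * (Var (fst e) * Var (snd e)))
      = (\<Sum>e\<in>edges G. if e = (u, v) then p * (Var u * Var v) else 0)"
    by (rule sum.cong) (auto simp: c_def)
  then have "p * (Var u * Var v) = (\<Sum>e\<in>edges G. c e * (Var (fst e) * Var (snd e)))"
    using assms(1,2) by simp
  moreover have "c e \<in> polyring (verts G)" for e
    using assms(3) by (simp add: c_def poly.zero_mem)
  ultimately show ?thesis
    unfolding edge_ideal_def by blast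
qed

lemma mult_edge_mem_mono_ideal:
  fixes p :: "('v, 'k::comm_ring_1) mpoly"
  assumes "simple_graph G" "(u, v) \<in> edges G" "p \<in> polyring (verts G)"
  shows "p * (Var u * Var v) \<in> mono_ideal (verts G) (edge_monos G)"
proof -
  have "var u + var v \<in> edge_monos G"
    using assms(2) by (auto simp: edge_monos_def)
  then have "(monom (var u + var v + 0) :: ('v, 'k) mpoly) \<in> mono_ideal (verts G) (edge_monos G)"
    using simple_graphD[OF assms(1)] assms(2)
    by (intro single_mem_mono_ideal) (auto simp: keys_add_nat)
  then show ?thesis
    using assms(3) by (simp add: mult_mem_mono_ideal Var_mult_Var)
qed

lemma edge_ideal_eq_mono_ideal:
  assumes "simple_graph G"
  shows "edge_ideal G = mono_ideal (verts G) (edge_monos G)"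
proof (intro equalityI subsetI)
  fix p :: "('a, 'b) mpoly"
  assume "p \<in> edge_ideal G"
  then obtain c where c_mem: "\<And>e. e \<in> edges G \<Longrightarrow> c e \<in> polyring (verts G)"
    and p_eq: "p = (\<Sum>e\<in>edges G. c e * (Var (fst e) * Var (snd e)))"
    by (auto simp: edge_ideal_def)
  have "c (u, v) * (Var u * Var v) \<in> mono_ideal (verts G) (edge_monos G)"
    if "(u, v) \<in> edges G" for u v
    using mult_edge_mem_mono_ideal[OF assms that c_mem[OF that]] .
  then show "p \<in> mono_ideal (verts G) (edge_monos G)"
    unfolding p_eq by (intro sum_mem_mono_ideal) auto
next
  fix p :: "('a, 'b) mpoly"
  assume "p \<in> mono_ideal (verts G) (edge_monos G)"
  then show "p \<in> edge_ideal G"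
  proof (induction rule: mono_ideal_induct)
    case zero
    show ?case by (rule zero_mem_edge_ideal)
  next
    case (add p q)
    then show ?case by (rule add_mem_edge_ideal)
  next
    case (single t s c)
    then obtain u v where edge: "(u, v) \<in> edges G" "t = var u + var v"
      by (auto simp: edge_monos_def)
    have "Poly_Mapping.single s c \<in> polyring (verts G)"
      using single(2) by (simp add: single_mem_polyring keys_add_nat)
    then have "Poly_Mapping.single s c * (Var u * Var v) \<in> edge_ideal G"
      by (rule mult_edge_mem_edge_ideal[OF simple_graphD(2)[OF assms] edge(1)])
    then show ?case
      by (simp add: edge(2) Var_mult_Var mult_single add.commute)
  qed
qed

lemma edge_monos_del_vertex:
  assumes "simple_graph H"
  shows "edge_monos H = edge_monos (del_vertex H x) \<union> (+) (var x) ` var ` neighbours H x"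
    (is "_ = ?deletion \<union> ?star")
proof (intro equalityI subsetI)
  fix t
  assume "t \<in> edge_monos H"
  then obtain u v where edge: "(u, v) \<in> edges H" "t = var u + var v"
    by (auto simp: edge_monos_def)
  consider (avoids) "u \<noteq> x" "v \<noteq> x" | (starts) "u = x" | (ends) "v = x" by blast
  then show "t \<in> ?deletion \<union> ?star"
  proof cases
    case avoids
    then show ?thesis
      using edge by (auto simp: edge_monos_def edges_del_vertex[OF assms])
  next
    case starts
    then show ?thesis
      using edge by (auto simp: mem_neighbours_iff[OF assms])
  next
    case ends
    then have "u \<in> neighbours H x" "t = var x + var u"
      using edge
      by (simp_all add: mem_neighbours_iff[OF assms] simple_graphD(5)[OF assms] add.commute)
    then show ?thesis by blast
  qed
qed (auto simp: edge_monos_def edges_del_vertex[OF assms] mem_neighbours_iff[OF assms])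

text \<open>Generators of the colon ideal \<open>I(H) : x\<close>.\<close>

definition colon_monos :: "'v graph \<Rightarrow> 'v \<Rightarrow> ('v \<Rightarrow>\<^sub>0 nat) set"
  where "colon_monos H x = edge_monos (del_star H x) \<union> var ` neighbours H x"

lemma colon_monos_dvd:
  assumes "simple_graph H" "t \<in> edge_monos (del_vertex H x)"
  shows "\<exists>s\<in>colon_monos H x. monom_dvd s t"
proof -
  obtain u v where edge: "(u, v) \<in> edges H" "u \<noteq> x" "v \<noteq> x" and t_eq: "t = var u + var v"
    using assms(2) by (auto simp: edge_monos_def edges_del_vertex[OF assms(1)])
  consider (starts) "u \<in> neighbours H x" | (ends) "v \<in> neighbours H x"
    | (avoids) "u \<notin> neighbours H x" "v \<notin> neighbours H x"
    by blast
  then show ?thesis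
  proof cases
    case starts
    then have "var u \<in> colon_monos H x" by (simp add: colon_monos_def)
    then show ?thesis
      unfolding t_eq monom_dvd_def by blast
  next
    case ends
    then have "var v \<in> colon_monos H x" by (simp add: colon_monos_def)
    then show ?thesis
      unfolding t_eq using monom_dvd_add_left monom_dvd_refl by blast
  next
    case avoids
    then have "t \<in> colon_monos H x"
      using edge by (auto simp: t_eq colon_monos_def edge_monos_def edges_del_star[OF assms(1)])
    then show ?thesis
      using monom_dvd_refl by blast
  qed
qed

lemma monomial_pd_le_edge_monos_iff:
  assumes "simple_graph H"
  shows "monomial_pd_le TYPE('k::comm_ring_1) V (edge_monos H) n \<longleftrightarrow>
    monomial_pd_le TYPE('k) V (edge_monos (del_vertex H x) \<union> (+) (var x) ` colon_monos H x) n"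
proof (rule monomial_pd_le_cong)
  fix t
  assume "t \<in> edge_monos H"
  then have "t \<in> edge_monos (del_vertex H x) \<union> (+) (var x) ` colon_monos H x"
    unfolding edge_monos_del_vertex[OF assms, of x] colon_monos_def by blast
  then show "\<exists>s\<in>edge_monos (del_vertex H x) \<union> (+) (var x) ` colon_monos H x. monom_dvd s t"
    using monom_dvd_refl by blast
next
  fix t
  assume "t \<in> edge_monos (del_vertex H x) \<union> (+) (var x) ` colon_monos H x"
  moreover have "edge_monos (del_star H x) \<subseteq> edge_monos (del_vertex H x)"
    by (auto simp: edge_monos_def edges_del_star[OF assms] edges_del_vertex[OF assms])
  ultimately show "\<exists>s\<in>edge_monos H. monom_dvd s t"
    unfolding edge_monos_del_vertex[OF assms, of x] colon_monos_def
    using monom_dvd_refl monom_dvd_add_left by blast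
qed

lemma monomial_pd_le_del_vertex_del_star:
  assumes "simple_graph H" "verts H \<subseteq> V" "x \<in> verts H"
    and "monomial_pd_le TYPE('k::comm_ring_1) V (edge_monos (del_vertex H x)) n"
    and "monomial_pd_le TYPE('k) V (edge_monos (del_star H x)) m"
  shows "monomial_pd_le TYPE('k) V (edge_monos H) (max (Suc n) (m + card (neighbours H x)))"
  unfolding monomial_pd_le_edge_monos_iff[OF assms(1), of _ _ x]
proof (rule monomial_pd_le_Un_shift)
  show "Poly_Mapping.keys (var x) \<subseteq> V"
    using assms(2,3) by auto
  show "Poly_Mapping.keys t \<inter> Poly_Mapping.keys (var x) = {}"
    if "t \<in> edge_monos (del_vertex H x)" for t
    using that by (auto simp: edge_monos_def edges_del_vertex[OF assms(1)] keys_add_nat)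
  show "monomial_pd_le TYPE('k) V (colon_monos H x) (m + card (neighbours H x))"
    unfolding colon_monos_def
  proof (rule monomial_pd_le_Un_vars)
    show "finite (neighbours H x)" "neighbours H x \<subseteq> V"
      using simple_graphD(1)[OF assms(1)] assms(2) by (auto simp: neighbours_def)
    show "Poly_Mapping.keys t \<inter> neighbours H x = {}" if "t \<in> edge_monos (del_star H x)" for t
      using that by (auto simp: edge_monos_def edges_del_star[OF assms(1)] keys_add_nat)
  qed (rule assms(5))
qed (simp_all add: assms(4) colon_monos_dvd[OF assms(1)])

section \<open>Depth bounds\<close>

text \<open>By the Auslander-Buchsbaum formula, \<open>card (verts H) - pd H\<close> is the depth of the quotient of
  the polynomial ring on \<open>verts H\<close> by the edge ideal of \<open>H\<close>.\<close>

definition depth_ge :: "'k::comm_ring_1 itself \<Rightarrow> 'v set \<Rightarrow> 'v graph \<Rightarrow> real \<Rightarrow> bool"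
  where "depth_ge k V H r \<longleftrightarrow>
    (\<exists>n. monomial_pd_le k V (edge_monos H) n \<and> real n \<le> real (card (verts H)) - r)"

lemma depth_ge_antimono: "depth_ge k V H r \<Longrightarrow> s \<le> r \<Longrightarrow> depth_ge k V H s"
  by (force simp: depth_ge_def)

lemma depth_ge_no_edges:
  "edges H = {} \<Longrightarrow> depth_ge TYPE('k::comm_ring_1) V H (card (verts H))"
  using monomial_pd_le_empty by (auto simp: depth_ge_def edge_monos_def)

lemma depth_ge_del_isolated:
  assumes "simple_graph H" "depth_ge k V (del_isolated H) r"
  shows "depth_ge k V H (r + card (isolated H))"
proof -
  have "edge_monos (del_isolated H) = edge_monos H"
    by (simp add: edge_monos_def edges_del_isolated[OF assms(1)])
  then show ?thesis
    using assms(2) card_verts_del_isolated[OF assms(1)] by (force simp: depth_ge_def)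
qed

lemma depth_ge_del_vertex_del_star:
  assumes "simple_graph H" "verts H \<subseteq> V" "x \<in> verts H"
    and "depth_ge TYPE('k::comm_ring_1) V (del_vertex H x) r"
    and "depth_ge TYPE('k) V (del_star H x) (r - 1)"
  shows "depth_ge TYPE('k) V H r"
proof -
  obtain n where pd_del_vertex: "monomial_pd_le TYPE('k) V (edge_monos (del_vertex H x)) n"
    and n_le: "real n \<le> real (card (verts (del_vertex H x))) - r"
    using assms(4) by (auto simp: depth_ge_def)
  obtain m where pd_del_star: "monomial_pd_le TYPE('k) V (edge_monos (del_star H x)) m"
    and m_le: "real m \<le> real (card (verts (del_star H x))) - (r - 1)"
    using assms(5) by (auto simp: depth_ge_def)
  have "real (max (Suc n) (m + card (neighbours H x))) \<le> real (card (verts H)) - r"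
    using n_le m_le card_verts_del_vertex[OF assms(1,3)] card_verts_del_star[OF assms(1,3)]
    by linarith
  then show ?thesis
    using monomial_pd_le_del_vertex_del_star[OF assms(1-3) pd_del_vertex pd_del_star]
    unfolding depth_ge_def by blast
qed

lemma depth_ge_del_vertices:
  assumes "simple_graph H" "verts H \<subseteq> V"
    and "\<forall>i<length vs. vs ! i \<in> verts (del_vertices H (take i vs))"
    and "\<forall>i<length vs.
      depth_ge TYPE('k::comm_ring_1) V (del_star (del_vertices H (take i vs)) (vs ! i)) (r - 1)"
    and "depth_ge TYPE('k) V (del_vertices H vs) r"
  shows "depth_ge TYPE('k) V H r"
  using assms(3-5)
proof (induction vs rule: rev_induct)
  case Nil
  then show ?case by (simp add: del_vertices_def)
next
  case (snoc x vs)
  let ?K = "del_vertices H vs"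
  have "depth_ge TYPE('k) V ?K r"
  proof (rule depth_ge_del_vertex_del_star)
    show "simple_graph ?K" "verts ?K \<subseteq> V"
      using assms(1,2) by (auto simp: del_vertices_eq_induced simple_graph_induced)
    show "x \<in> verts ?K" "depth_ge TYPE('k) V (del_star ?K x) (r - 1)"
      using snoc.prems(1,2)[rule_format, of "length vs"] by simp_all
    show "depth_ge TYPE('k) V (del_vertex ?K x) r"
      using snoc.prems(3) by (simp add: del_vertices_snoc)
  qed
  moreover have "\<forall>i<length vs. vs ! i \<in> verts (del_vertices H (take i vs))"
    "\<forall>i<length vs. depth_ge TYPE('k) V (del_star (del_vertices H (take i vs)) (vs ! i)) (r - 1)"
    using snoc.prems(1,2) by (auto simp: nth_append dest: less_SucI)
  ultimately show ?case by (intro snoc.IH)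
qed

lemma depth_ge_vertex_sequence:
  assumes "hereditary C" "\<forall>K\<in>C. simple_graph K" "H \<in> C" "verts H \<subseteq> V"
    and smaller: "\<And>K. K \<in> C \<Longrightarrow> verts K \<subset> verts H \<Longrightarrow> depth_ge TYPE('k::comm_ring_1) V K (f K)"
    and "vs \<noteq> []" and mem: "\<forall>i<length vs. vs ! i \<in> verts (del_vertices H (take i vs))"
    and star_bound: "\<forall>i<length vs. f (del_star (del_vertices H (take i vs)) (vs ! i)) + 1 \<ge> r"
    and isolated_bound:
      "f (del_isolated (del_vertices H vs)) + card (isolated (del_vertices H vs)) \<ge> r"
  shows "depth_ge TYPE('k) V H r"
proof (rule depth_ge_del_vertices[OF _ \<open>verts H \<subseteq> V\<close> mem])
  show simple: "simple_graph H"
    using assms(2,3) by blast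
  note del_vertices_eq = del_vertices_eq_induced[OF simple]
  have induced_mem: "induced (del_vertices H ws) W \<in> C" for ws W
    using hereditary_induced[OF assms(1,3) simple] by (simp add: del_vertices_eq)
  show "\<forall>i<length vs. depth_ge TYPE('k) V (del_star (del_vertices H (take i vs)) (vs ! i)) (r - 1)"
  proof (intro allI impI)
    fix i
    assume "i < length vs"
    let ?K = "del_star (del_vertices H (take i vs)) (vs ! i)"
    have "verts ?K \<subset> verts H"
      using mem \<open>i < length vs\<close> by (auto simp: del_vertices_eq verts_del_star)
    then have "depth_ge TYPE('k) V ?K (f ?K)"
      using induced_mem by (intro smaller) (simp_all add: del_star_def)
    moreover have "r - 1 \<le> f ?K"
      using star_bound \<open>i < length vs\<close> by (simp add: algebra_simps)
    ultimately show "depth_ge TYPE('k) V ?K (r - 1)"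
      by (rule depth_ge_antimono)
  qed
  let ?K = "del_vertices H vs"
  have "vs ! 0 \<in> verts H" "vs ! 0 \<in> set vs"
    using mem \<open>vs \<noteq> []\<close> by (auto simp: del_vertices_def)
  then have "verts (del_isolated ?K) \<subset> verts H"
    by (auto simp: del_vertices_eq del_isolated_def)
  then have "depth_ge TYPE('k) V (del_isolated ?K) (f (del_isolated ?K))"
    using induced_mem by (intro smaller) (simp_all add: del_isolated_def)
  then show "depth_ge TYPE('k) V ?K r"
    using depth_ge_antimono[OF depth_ge_del_isolated isolated_bound] simple_graph_induced[OF simple]
    by (simp add: del_vertices_eq)
qed

lemma pd_le_if_depth_ge:
  assumes "simple_graph G" "depth_ge TYPE('k::field) (verts G) G r"
  shows "real (pd TYPE('k) G) \<le> real (card (verts G)) - r"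
proof -
  obtain n where "monomial_pd_le TYPE('k) (verts G) (edge_monos G) n"
    and n_le: "real n \<le> real (card (verts G)) - r"
    using assms(2) by (auto simp: depth_ge_def)
  then have "pd TYPE('k) G \<le> n"
    by (intro pd_le_if_resolvable)
      (simp_all add: monomial_pd_le_def edge_ideal_eq_mono_ideal[OF assms(1)]
        mono_ideal_subset_polyring)
  then show ?thesis using n_le by linarith
qed

theorem theorem3p1:
  fixes C :: "'v graph set" and f :: "'v graph \<Rightarrow> real"
  assumes graphs: "\<forall>G\<in>C. simple_graph G"
    and her: "hereditary C"
    and cond1: "\<forall>G\<in>C. edges G = {} \<longrightarrow> f G \<le> real (card (verts G))"
    and cond23: "\<forall>G\<in>C. edges G \<noteq> {} \<longrightarrow>
       (\<exists>vs. vs \<noteq> [] \<and>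
          (\<forall>i<length vs. vs ! i \<in> verts (del_vertices G (take i vs))) \<and>
          (\<forall>i<length vs. f (del_star (del_vertices G (take i vs)) (vs ! i)) + 1 \<ge> f G) \<and>
          f (del_isolated (del_vertices G vs))
            + real (card (isolated (del_vertices G vs))) \<ge> f G)"
    and G: "G \<in> C"
  shows "real (pd TYPE('k::field) G) \<le> real (card (verts G)) - f G"
proof -
  have "depth_ge TYPE('k) (verts G) H (f H)" if "H \<in> C" "verts H \<subseteq> verts G" for H
    using that
  proof (induction "card (verts H)" arbitrary: H rule: less_induct)
    case less
    have simple: "simple_graph H" using graphs less.prems(1) by blast
    have smaller: "depth_ge TYPE('k) (verts G) K (f K)" if "K \<in> C" "verts K \<subset> verts H" for K
      using less.hyps psubset_card_mono[OF simple_graphD(1)[OF simple] that(2)] less.prems(2) that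
      by blast
    show ?case
    proof (cases "edges H = {}")
      case True
      then show ?thesis
        using cond1 less.prems(1) by (blast intro: depth_ge_antimono depth_ge_no_edges)
    next
      case False
      then show ?thesis
        using cond23 less.prems depth_ge_vertex_sequence[OF her graphs _ _ smaller] by blast
    qed
  qed
  then show ?thesis
    using G graphs pd_le_if_depth_ge by blast
qed

end
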